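(* Let $\mathbb{E},\mathbb{F}$ be finite-dimensional real inner-product spaces, $K\subseteq\mathbb{E}$ a pointed closed convex cone with nonempty interior, $\mathcal{A}\colon\mathbb{E}\to\mathbb{F}^*$ linear, $b\in\mathbb{F}^*$, and $\mathcal{C}:=\{x\in K : \mathcal{A}(x)=b\}$. Suppose $\mathcal{C}\cap\operatorname{int}(K)\neq\emptyset$ and $\mathcal{C}$ is compact. Then the following are equivalent: (i) for every $c\in\mathbb{E}^*\setminus[\operatorname{cone}(\mathcal{C})]^\circ$, the optimization problem $\max\{\langle c,x\rangle : \mathcal{A}(x)=b,\ x\in K\}$ and its dual have a strictly complementary pair of optimal solutions; (ii) $\mathcal{C}^\circ$ is facially exposed.
   Context: $K^*:=\{s\in\mathbb{E}^*:\langle s,x\rangle\ge0\ \forall x\in K\}$. The dual problem is $\min\{\langle b,y\rangle : y\in\mathbb{F},\ \mathcal{A}^*(y)-c\in K^*\}$, with slack $s=\mathcal{A}^*(y)-c$. A strictly complementary pair of optimal solutions is a primal optimal $\bar x$ and a dual optimal $\bar y$ with slack $\bar s$ such that there is a face $F$ of $K$ with $\bar x\in\operatorname{relint}(F)$ and $\bar s\in\operatorname{relint}(K^*\cap F^\perp)$. For $D\subseteq\mathbb{E}$, $D^\circ:=\{y\in\mathbb{E}^*:\langle y,x\rangle\le1\ \forall x\in D\}$ is the polar; $\operatorname{cone}(\mathcal{C})$ is the smallest convex cone containing $\mathcal{C}$ together with the origin. A convex set is facially exposed if all its faces are exposed (i.e., of the form $D\cap H$ for a supporting hyperplane $H$,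 or trivial). *)

theory Defs
  imports "HOL-Analysis.Analysis"
begin

(* E^* and F^* are identified with E and F via the inner product. *)

definition polar :: "'a::real_inner set \<Rightarrow> 'a set" where
  "polar D = {y. \<forall>x\<in>D. y \<bullet> x \<le> 1}"

definition dual_cone :: "'a::real_inner set \<Rightarrow> 'a set" where
  "dual_cone K = {s. \<forall>x\<in>K. s \<bullet> x \<ge> 0}"

definition orth :: "'a::real_inner set \<Rightarrow> 'a set" where
  "orth F = {s. \<forall>x\<in>F. s \<bullet> x = 0}"

definition facially_exposed :: "'a::euclidean_space set \<Rightarrow> bool" where
  "facially_exposed D \<longleftrightarrow> (\<forall>F. F face_of D \<longrightarrow> F exposed_face_of D)"

(* primal: max { <c,x> : A x = b, x \<in> K } *)
definition primal_optimal ::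
  "('e::euclidean_space \<Rightarrow> 'f::euclidean_space) \<Rightarrow> 'f \<Rightarrow> 'e set \<Rightarrow> 'e \<Rightarrow> 'e \<Rightarrow> bool" where
  "primal_optimal A b K c x \<longleftrightarrow>
     x \<in> K \<and> A x = b \<and> (\<forall>x'. x' \<in> K \<and> A x' = b \<longrightarrow> c \<bullet> x' \<le> c \<bullet> x)"

(* dual: min { <b,y> : A^*(y) - c \<in> K^* } *)
definition dual_optimal ::
  "('e::euclidean_space \<Rightarrow> 'f::euclidean_space) \<Rightarrow> 'f \<Rightarrow> 'e set \<Rightarrow> 'e \<Rightarrow> 'f \<Rightarrow> bool" where
  "dual_optimal A b K c y \<longleftrightarrow>
     adjoint A y - c \<in> dual_cone K \<and>
     (\<forall>y'. adjoint A y' - c \<in> dual_cone K \<longrightarrow> b \<bullet> y \<le> b \<bullet> y')"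

definition strictly_complementary ::
  "('e::euclidean_space \<Rightarrow> 'f::euclidean_space) \<Rightarrow> 'f \<Rightarrow> 'e set \<Rightarrow> 'e \<Rightarrow> 'e \<Rightarrow> 'f \<Rightarrow> bool" where
  "strictly_complementary A b K c x y \<longleftrightarrow>
     primal_optimal A b K c x \<and> dual_optimal A b K c y \<and>
     (\<exists>F. F face_of K \<and> x \<in> rel_interior F \<and>
          adjoint A y - c \<in> rel_interior (dual_cone K \<inter> orth F))"

end

theory Submission
  imports Defs
begin

text \<open>
  Under the Slater condition and compactness of \<open>C\<close>, the polar \<open>C\<degree>\<close> consists exactly of the
  vectors \<open>A\<^sup>*(w) - s\<close> with \<open>\<langle>b,w\<rangle> \<le> 1\<close> and \<open>s \<in> K\<^sup>*\<close>. Hence, for \<open>x \<in> C\<close> in the relative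
  interior of a face \<open>F\<close> of \<open>K\<close>, the face of \<open>C\<degree>\<close> exposed by \<open>x\<close> is
  \<open>A\<^sup>*{w. \<langle>b,w\<rangle> = 1} - (K\<^sup>* \<inter> F\<^sup>\<bottom>)\<close>, and its relative interior is obtained by replacing
  \<open>K\<^sup>* \<inter> F\<^sup>\<bottom>\<close> with its relative interior. Normalising \<open>c\<close> to \<open>y\<close> with \<open>max\<^sub>C \<langle>y,\<cdot>\<rangle> = 1\<close>
  puts \<open>y\<close> on the boundary of \<open>C\<degree>\<close>, and a primal optimal \<open>x\<close> then has a strictly
  complementary dual solution exactly when \<open>y\<close> lies in the relative interior of the face of
  \<open>C\<degree>\<close> exposed by \<open>x\<close>.

  If \<open>C\<degree>\<close> is facially exposed, the face having \<open>y\<close> in its relative interior is exposed, and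
  its exposing functional, suitably scaled, is such an \<open>x\<close>. Conversely, a point \<open>y\<close> in the
  relative interior of a proper face \<open>G\<close> of \<open>C\<degree>\<close> is a boundary point, and strict
  complementarity for \<open>c = y\<close> places \<open>y\<close> in the relative interior of an exposed face, which
  must then be \<open>G\<close>.
\<close>

section \<open>Faces, dual cones and polars\<close>

lemma exists_face_of_rel_interior:
  fixes S :: "'a::euclidean_space set"
  assumes "convex S" "x \<in> S"
  shows "\<exists>F. F face_of S \<and> x \<in> rel_interior F"
  using assms
proof (induction "nat (aff_dim S + 1)" arbitrary: S rule: less_induct)
  case less
  show ?case
  proof (cases "x \<in> rel_interior S")
    case True
    then show ?thesis using face_of_refl[OF less.prems(1)] by blast
  next
    case False
    obtain a where a: "a \<noteq> 0" "\<And>y. y \<in> S \<Longrightarrow> a \<bullet> x \<le> a \<bullet> y"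
      "\<And>y. y \<in> rel_interior S \<Longrightarrow> a \<bullet> x < a \<bullet> y"
      using supporting_hyperplane_rel_boundary[OF less.prems False] by blast
    define T where "T = S \<inter> {y. a \<bullet> y = a \<bullet> x}"
    have T: "T face_of S" unfolding T_def
      by (rule face_of_Int_supporting_hyperplane_ge) (use less.prems a in auto)
    have "rel_interior S \<noteq> {}" using less.prems rel_interior_eq_empty by blast
    then have "T \<noteq> S" unfolding T_def using a(3) rel_interior_subset by force
    then have "aff_dim T < aff_dim S" using face_of_aff_dim_lt[OF less.prems(1) T] by simp
    moreover have "aff_dim T \<ge> -1" by (simp add: aff_dim_geq)
    ultimately have "nat (aff_dim T + 1) < nat (aff_dim S + 1)" by linarith
    moreover have "convex T" using T face_of_imp_convex by blast
    moreover have "x \<in> T" using less.prems unfolding T_def by auto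
    ultimately obtain F where "F face_of T" "x \<in> rel_interior F" using less.hyps by blast
    then show ?thesis using face_of_trans T by blast
  qed
qed

lemma nonneg_on_convex_vanishes_if_vanishes_at_rel_interior:
  fixes F :: "'a::euclidean_space set"
  assumes "convex F" "x \<in> rel_interior F" "\<And>z. z \<in> F \<Longrightarrow> s \<bullet> z \<ge> 0" "s \<bullet> x = 0"
    and "z \<in> F"
  shows "s \<bullet> z = 0"
proof -
  have "(F \<inter> {z. s \<bullet> z = 0}) face_of F"
    by (rule face_of_Int_supporting_hyperplane_ge) (use assms in auto)
  moreover have "(F \<inter> {z. s \<bullet> z = 0}) \<inter> rel_interior F \<noteq> {}"
    using assms(2,4) rel_interior_subset by blast
  ultimately show ?thesis using subset_of_face_of[of _ F F] \<open>z \<in> F\<close> by blast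
qed

lemma rel_interior_conic_scaleR:
  fixes S :: "'a::euclidean_space set"
  assumes "conic S" "t > 0" "s \<in> rel_interior S"
  shows "t *\<^sub>R s \<in> rel_interior S"
proof -
  have "(*\<^sub>R) t ` S = S"
  proof
    show "(*\<^sub>R) t ` S \<subseteq> S" using assms(1,2) by (auto intro: conicD)
    show "S \<subseteq> (*\<^sub>R) t ` S"
    proof
      fix u assume "u \<in> S"
      then have "(1/t) *\<^sub>R u \<in> S" using assms(1,2) by (auto intro: conicD)
      moreover have "u = t *\<^sub>R ((1/t) *\<^sub>R u)" using assms(2) by simp
      ultimately show "u \<in> (*\<^sub>R) t ` S" by blast
    qed
  qed
  then show ?thesis using rel_interior_scaleR[of t S] assms(2,3) by auto
qed

lemma dual_cone_eq: "dual_cone K = (\<Inter>x\<in>K. {s. x \<bullet> s \<ge> 0})"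
  by (auto simp: dual_cone_def inner_commute)

lemma closed_dual_cone: "closed (dual_cone K)"
  unfolding dual_cone_eq by (intro closed_INT ballI closed_halfspace_ge)

lemma convex_dual_cone: "convex (dual_cone K)"
  unfolding dual_cone_eq by (intro convex_INT convex_halfspace_ge)

lemma conic_dual_cone: "conic (dual_cone K)"
  unfolding conic_def dual_cone_def by auto

lemma zero_in_dual_cone: "0 \<in> dual_cone K"
  unfolding dual_cone_def by auto

lemma convex_orth: "convex (orth F)"
proof -
  have "orth F = (\<Inter>x\<in>F. {s. x \<bullet> s = 0})" by (auto simp: orth_def inner_commute)
  then show ?thesis by (simp add: convex_INT convex_hyperplane)
qed

lemma conic_dual_cone_Int_orth: "conic (dual_cone K \<inter> orth F)"
  unfolding conic_def dual_cone_def orth_def by auto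

lemma mem_cone_if_nonneg_on_dual_cone:
  fixes K :: "'a::euclidean_space set"
  assumes "closed K" "convex K" "conic K" "K \<noteq> {}"
    and "\<And>s. s \<in> dual_cone K \<Longrightarrow> x \<bullet> s \<ge> 0"
  shows "x \<in> K"
proof (rule ccontr)
  assume "x \<notin> K"
  then obtain a c where ac: "a \<bullet> x < c" "\<forall>y\<in>K. c < a \<bullet> y"
    using separating_hyperplane_closed_point[OF assms(2,1)] by blast
  have "0 \<in> K" using assms(3,4) conic_contains_0 by blast
  then have c0: "c < 0" using ac by force
  have "a \<in> dual_cone K"
    unfolding dual_cone_def
  proof (clarify, rule ccontr)
    fix y assume y: "y \<in> K" "\<not> 0 \<le> a \<bullet> y"
    define t where "t = c / (a \<bullet> y)"
    have "t \<ge> 0" using c0 y by (simp add: t_def divide_nonpos_neg)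
    then have "c < a \<bullet> (t *\<^sub>R y)" using ac conicD[OF assms(3) y(1)] by blast
    moreover have "a \<bullet> (t *\<^sub>R y) = c" using y by (simp add: t_def)
    ultimately show False by simp
  qed
  then have "x \<bullet> a \<ge> 0" using assms(5) by blast
  then show False using ac c0 by (simp add: inner_commute)
qed

lemma norm_le_inner_if_cball_subset:
  fixes x0 :: "'a::real_inner"
  assumes "cball x0 r \<subseteq> K" "r > 0" "s \<in> dual_cone K"
  shows "r * norm s \<le> s \<bullet> x0"
proof (cases "s = 0")
  case False
  have "x0 - (r / norm s) *\<^sub>R s \<in> K" using assms(1,2) False by (auto simp: dist_norm)
  then have "0 \<le> s \<bullet> (x0 - (r / norm s) *\<^sub>R s)" using assms(3) by (simp add: dual_cone_def)
  also have "\<dots> = s \<bullet> x0 - r * norm s"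
    using False by (simp add: inner_diff_right power2_norm_eq_inner[symmetric] power2_eq_square)
  finally show ?thesis by simp
qed simp

lemma compact_dual_cone_Int_halfspace:
  fixes x0 :: "'a::euclidean_space"
  assumes "cball x0 r \<subseteq> K" "r > 0"
  shows "compact (dual_cone K \<inter> {s. x0 \<bullet> s \<le> R})"
proof -
  have "norm s \<le> R / r" if "s \<in> dual_cone K" "x0 \<bullet> s \<le> R" for s
    using norm_le_inner_if_cball_subset[OF assms that(1)] that(2) assms(2)
    by (simp add: le_divide_eq inner_commute mult.commute)
  then have "bounded (dual_cone K \<inter> {s. x0 \<bullet> s \<le> R})" by (auto simp: bounded_iff)
  then show ?thesis
    by (simp add: compact_eq_bounded_closed closed_Int closed_dual_cone closed_halfspace_le)
qed

lemma convex_polar: "convex (polar C)"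
proof -
  have "polar C = (\<Inter>x\<in>C. {y. x \<bullet> y \<le> 1})" by (auto simp: polar_def inner_commute)
  then show ?thesis by (simp add: convex_INT convex_halfspace_le)
qed

lemma polar_convex_cone_hull:
  fixes C :: "'a::real_inner set"
  shows "polar (convex_cone hull C) = {c. \<forall>x\<in>C. c \<bullet> x \<le> 0}"
proof
  show "polar (convex_cone hull C) \<subseteq> {c. \<forall>x\<in>C. c \<bullet> x \<le> 0}"
  proof (clarify, rule ccontr)
    fix c x assume c: "c \<in> polar (convex_cone hull C)" and x: "x \<in> C" "\<not> c \<bullet> x \<le> 0"
    have "(2 / (c \<bullet> x)) *\<^sub>R x \<in> convex_cone hull C"
      using x by (intro conicD[OF conic_convex_cone_hull] hull_inc) auto
    then have "c \<bullet> ((2 / (c \<bullet> x)) *\<^sub>R x) \<le> 1" using c unfolding polar_def by blast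
    then show False using x(2) by simp
  qed
  show "{c. \<forall>x\<in>C. c \<bullet> x \<le> 0} \<subseteq> polar (convex_cone hull C)"
  proof clarify
    fix c assume "\<forall>x\<in>C. c \<bullet> x \<le> 0"
    then have "convex_cone hull C \<subseteq> {x. c \<bullet> x \<le> 0}"
      by (intro hull_minimal convex_cone_halfspace_le) auto
    then show "c \<in> polar (convex_cone hull C)" unfolding polar_def by fastforce
  qed
qed

lemma in_interior_polar_if_strictly_bounded:
  fixes C :: "'a::real_inner set"
  assumes "bounded C" "\<And>x. x \<in> C \<Longrightarrow> y \<bullet> x \<le> m" "m < 1"
  shows "y \<in> interior (polar C)"
proof -
  obtain M where M: "M > 0" "\<And>x. x \<in> C \<Longrightarrow> norm x \<le> M" using assms(1) by (auto simp: bounded_pos)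
  have "ball y ((1 - m) / M) \<subseteq> polar C"
  proof
    fix y' assume y': "y' \<in> ball y ((1 - m) / M)"
    have "y' \<bullet> x \<le> 1" if x: "x \<in> C" for x
    proof -
      have "(y' - y) \<bullet> x \<le> norm (y' - y) * norm x"
        using Cauchy_Schwarz_ineq2[of "y' - y" x] by linarith
      also have "\<dots> \<le> norm (y' - y) * M" using M(2)[OF x] by (simp add: mult_left_mono)
      also have "\<dots> < 1 - m"
        using y' M(1) by (simp add: dist_norm norm_minus_commute less_divide_eq)
      finally show ?thesis using assms(2)[OF x] by (simp add: inner_diff_left)
    qed
    then show "y' \<in> polar C" by (simp add: polar_def)
  qed
  moreover have "(1 - m) / M > 0" using assms(3) M(1) by simp
  ultimately show ?thesis using mem_interior by blast
qed

lemma rel_interior_polar_eq_interior: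
  fixes C :: "'a::euclidean_space set"
  assumes "bounded C"
  shows "rel_interior (polar C) = interior (polar C)"
proof -
  have "0 \<in> interior (polar C)"
    by (rule in_interior_polar_if_strictly_bounded[OF assms, where m = 0]) auto
  then show ?thesis using rel_interior_nonempty_interior by blast
qed

lemma not_in_interior_polar:
  fixes C :: "'a::euclidean_space set"
  assumes "x \<in> C" "x \<noteq> 0" "y \<bullet> x = 1"
  shows "y \<notin> interior (polar C)"
proof -
  have "polar C \<subseteq> {z. x \<bullet> z \<le> 1}" using assms(1) by (auto simp: polar_def inner_commute)
  then have "interior (polar C) \<subseteq> interior {z. x \<bullet> z \<le> 1}" by (rule interior_mono)
  also have "\<dots> = {z. x \<bullet> z < 1}" using assms(2) by simp
  finally show ?thesis using assms(3) by (auto simp: inner_commute)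
qed

lemma polar_frontier_point_attained:
  fixes C :: "'a::euclidean_space set"
  assumes "compact C" "C \<noteq> {}" "y \<in> polar C" "y \<notin> interior (polar C)"
  shows "\<exists>x\<in>C. y \<bullet> x = 1"
proof -
  have "continuous_on C (\<lambda>x. y \<bullet> x)" by (intro continuous_intros)
  then obtain x where x: "x \<in> C" "\<forall>x'\<in>C. y \<bullet> x' \<le> y \<bullet> x"
    using continuous_attains_sup[OF assms(1,2)] by blast
  have "\<not> y \<bullet> x < 1"
    using in_interior_polar_if_strictly_bounded[OF compact_imp_bounded[OF assms(1)]] x assms(4)
    by blast
  then show ?thesis using x assms(3) by (force simp: polar_def)
qed

lemma exposed_face_of_polar_Int_hyperplane:
  fixes C :: "'a::euclidean_space set"
  assumes "x \<in> C"
  shows "(polar C \<inter> {z. z \<bullet> x = 1}) exposed_face_of polar C"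
proof -
  have "(polar C \<inter> {z. x \<bullet> z = 1}) exposed_face_of polar C"
    by (rule exposed_face_of_Int_supporting_hyperplane_le[OF convex_polar])
      (use assms in \<open>auto simp: polar_def inner_commute\<close>)
  then show ?thesis by (simp add: inner_commute)
qed

lemma nonneg_multiple_if_bounded_on_halfspace:
  fixes v b :: "'a::real_inner"
  assumes "b \<noteq> 0" and bounded: "\<And>w. b \<bullet> w \<le> 1 \<Longrightarrow> v \<bullet> w \<le> k"
  obtains \<mu> where "v = \<mu> *\<^sub>R b" "0 \<le> \<mu>" "\<mu> \<le> k"
proof -
  have bb: "b \<bullet> b > 0" using assms(1) by simp
  define \<mu> where "\<mu> = (v \<bullet> b) / (b \<bullet> b)"
  define d where "d = v - \<mu> *\<^sub>R b"
  have db: "b \<bullet> d = 0" using bb by (simp add: d_def \<mu>_def inner_diff_right inner_commute)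
  have "d = 0"
  proof (rule ccontr)
    assume "d \<noteq> 0"
    then have dd: "d \<bullet> d > 0" by simp
    define t where "t = (\<bar>k\<bar> + 1) / (d \<bullet> d)"
    have "v \<bullet> (t *\<^sub>R d) \<le> k" using db by (intro bounded) simp
    moreover have "v \<bullet> (t *\<^sub>R d) = t * (d \<bullet> d)"
      using db by (simp add: d_def inner_diff_left inner_commute)
    moreover have "t * (d \<bullet> d) = \<bar>k\<bar> + 1" using dd by (simp add: t_def)
    ultimately show False by linarith
  qed
  then have v: "v = \<mu> *\<^sub>R b" by (simp add: d_def)
  have "\<mu> \<ge> 0"
  proof (rule ccontr)
    assume neg: "\<not> \<mu> \<ge> 0"
    define t where "t = (\<bar>k\<bar> + 1) / (- \<mu> * (b \<bullet> b))"
    have "- \<mu> * (b \<bullet> b) > 0" using mult_pos_pos[of "- \<mu>" "b \<bullet> b"] neg bb by linarith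
    then have "t > 0" unfolding t_def by (intro divide_pos_pos) auto
    then have "0 \<le> t * (b \<bullet> b)" using bb by simp
    then have "v \<bullet> (- t *\<^sub>R b) \<le> k" by (intro bounded) simp
    moreover have "v \<bullet> (- t *\<^sub>R b) = \<bar>k\<bar> + 1" using v neg bb by (simp add: t_def)
    ultimately show False by linarith
  qed
  moreover have "\<mu> \<le> k" using bounded[of "(1 / (b \<bullet> b)) *\<^sub>R b"] v bb by simp
  ultimately show ?thesis using v that by blast
qed

section \<open>Conic programs with a compact feasible set\<close>

locale compact_conic_program =
  fixes K :: "'e::euclidean_space set" and A :: "'e \<Rightarrow> 'f::euclidean_space" and b :: 'f
  assumes closed_K: "closed K" and convex_K: "convex K" and conic_K: "conic K"
    and pointed_K: "K \<inter> uminus ` K = {0}"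
    and interior_K: "interior K \<noteq> {}"
    and linear_A: "linear A"
    and slater: "{x \<in> K. A x = b} \<inter> interior K \<noteq> {}"
    and compact_feasible: "compact {x \<in> K. A x = b}"
begin

abbreviation feasible :: "'e set" where
  "feasible \<equiv> {x \<in> K. A x = b}"

lemma inner_adjoint: "x \<bullet> adjoint A w = A x \<bullet> w"
  using adjoint_works[OF linear_A] .

lemma linear_adjoint: "linear (adjoint A)"
  using adjoint_linear[OF linear_A] .

lemma inner_adjoint_feasible: "x \<in> feasible \<Longrightarrow> adjoint A w \<bullet> x = b \<bullet> w"
  using inner_adjoint[of x w] by (simp add: inner_commute)

lemma convex_cone_K: "convex_cone K"
  using interior_K interior_subset convex_K conic_K by (auto simp: convex_cone_def)

lemma feasible_nonempty: "feasible \<noteq> {}"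
  using slater by blast

lemma obtain_slater_ball:
  obtains x0 r where "x0 \<in> feasible" "r > 0" "cball x0 r \<subseteq> K"
  using slater mem_interior_cball by blast

lemma eq_0_if_mem_K_kernel:
  assumes "x \<in> K" "A x = 0"
  shows "x = 0"
proof (rule ccontr)
  assume nz: "x \<noteq> 0"
  obtain x0 where x0: "x0 \<in> K" "A x0 = b" using feasible_nonempty by blast
  obtain M where M: "M > 0" "\<And>x. x \<in> feasible \<Longrightarrow> norm x \<le> M"
    using compact_imp_bounded[OF compact_feasible] by (auto simp: bounded_pos)
  define t where "t = (M + norm x0 + 1) / norm x"
  have t: "t \<ge> 0" unfolding t_def by (rule divide_nonneg_pos) (use M(1) nz in auto)
  \<comment> \<open>The ray \<open>x0 + t x\<close> stays feasible, contradicting boundedness.\<close>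
  have "x0 + t *\<^sub>R x \<in> K" by (rule convex_cone_add[OF convex_cone_K x0(1) conicD[OF conic_K assms(1) t]])
  moreover have "A (x0 + t *\<^sub>R x) = b" using x0 assms(2) linear_add[OF linear_A] linear_scale[OF linear_A] by simp
  ultimately have "norm (x0 + t *\<^sub>R x) \<le> M" using M(2) by blast
  moreover have "norm (t *\<^sub>R x) = M + norm x0 + 1" using nz M(1) t by (simp add: t_def)
  moreover have "norm (t *\<^sub>R x) \<le> norm (x0 + t *\<^sub>R x) + norm x0"
    using norm_triangle_ineq4[of "x0 + t *\<^sub>R x" x0] by simp
  ultimately show False by linarith
qed

lemma b_nonzero: "b \<noteq> 0"
proof
  assume b0: "b = 0"
  obtain x0 where x0: "x0 \<in> feasible" "x0 \<in> interior K" using slater by blast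
  then have "0 \<in> interior K" using eq_0_if_mem_K_kernel b0 by auto
  then obtain e where e: "e > 0" "ball 0 e \<subseteq> K" using mem_interior by blast
  obtain u :: 'e where u: "u \<in> Basis" using nonempty_Basis by blast
  define v where "v = (e/2) *\<^sub>R u"
  have nv: "norm v = e/2" using e u by (simp add: v_def)
  have "v \<in> K" "-v \<in> K" using e nv by (auto intro!: subsetD[OF e(2)])
  then have "v \<in> K \<inter> uminus ` K" by (metis IntI image_eqI minus_minus)
  then have "v = 0" using pointed_K by blast
  then show False using nv e by simp
qed

lemma nonzero_if_feasible: "x \<in> feasible \<Longrightarrow> x \<noteq> 0"
  using b_nonzero linear_0[OF linear_A] by auto

lemma inverse_scaleR_feasible:
  assumes "x \<in> K" "A x = \<mu> *\<^sub>R b" "\<mu> > 0"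
  shows "(1 / \<mu>) *\<^sub>R x \<in> feasible"
proof -
  have "(1 / \<mu>) *\<^sub>R x \<in> K" using conicD[OF conic_K assms(1)] assms(3) by simp
  moreover have "A ((1 / \<mu>) *\<^sub>R x) = b" using assms(2,3) linear_scale[OF linear_A] by simp
  ultimately show ?thesis by simp
qed

definition generators :: "'e set" where
  "generators = (\<Union>v \<in> adjoint A ` {w. b \<bullet> w \<le> 1}. \<Union>s \<in> dual_cone K. {v - s})"

lemma mem_generators:
  "z \<in> generators \<longleftrightarrow> (\<exists>w s. b \<bullet> w \<le> 1 \<and> s \<in> dual_cone K \<and> z = adjoint A w - s)"
  unfolding generators_def by blast

lemma convex_generators: "convex generators"
  unfolding generators_def
  by (intro convex_differences convex_linear_image linear_adjoint convex_halfspace_le convex_dual_cone)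

lemma generators_subset_polar: "generators \<subseteq> polar feasible"
proof
  fix z assume "z \<in> generators"
  then obtain w s where ws: "b \<bullet> w \<le> 1" "s \<in> dual_cone K" "z = adjoint A w - s"
    by (auto simp: mem_generators)
  have "z \<bullet> x \<le> 1" if x: "x \<in> feasible" for x
  proof -
    have "z \<bullet> x = b \<bullet> w - s \<bullet> x"
      using ws(3) inner_adjoint_feasible[OF x, of w] by (simp add: inner_diff_left)
    moreover have "s \<bullet> x \<ge> 0" using ws(2) x by (simp add: dual_cone_def)
    ultimately show ?thesis using ws(1) by linarith
  qed
  then show "z \<in> polar feasible" by (simp add: polar_def)
qed

lemma ray_if_bounded_on_generators:
  assumes bounded: "\<And>z. z \<in> generators \<Longrightarrow> x \<bullet> z \<le> k"
  obtains \<mu> where "x \<in> K" "A x = \<mu> *\<^sub>R b" "0 \<le> \<mu>" "\<mu> \<le> k"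
proof -
  have "x \<bullet> s \<ge> 0" if s: "s \<in> dual_cone K" for s
  proof (rule ccontr)
    assume neg: "\<not> x \<bullet> s \<ge> 0"
    define t where "t = (\<bar>k\<bar> + 1) / (- (x \<bullet> s))"
    have "t \<ge> 0" unfolding t_def by (rule divide_nonneg_pos) (use neg in auto)
    then have "adjoint A 0 - t *\<^sub>R s \<in> generators"
      unfolding mem_generators using conicD[OF conic_dual_cone s] by force
    then have "x \<bullet> (adjoint A 0 - t *\<^sub>R s) \<le> k" by (rule bounded)
    moreover have "x \<bullet> (adjoint A 0 - t *\<^sub>R s) = \<bar>k\<bar> + 1"
      using neg linear_0[OF linear_adjoint] by (simp add: t_def)
    ultimately show False by linarith
  qed
  then have "x \<in> K"
    using mem_cone_if_nonneg_on_dual_cone closed_K convex_K conic_K interior_K interior_subset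
    by blast
  moreover have "A x \<bullet> w \<le> k" if "b \<bullet> w \<le> 1" for w
  proof -
    have "adjoint A w - 0 \<in> generators"
      using that zero_in_dual_cone unfolding mem_generators by blast
    then show ?thesis using bounded inner_adjoint[of x w] by fastforce
  qed
  then obtain \<mu> where "A x = \<mu> *\<^sub>R b" "0 \<le> \<mu>" "\<mu> \<le> k"
    using nonneg_multiple_if_bounded_on_halfspace[OF b_nonzero] by blast
  ultimately show ?thesis using that by blast
qed

lemma mem_generators_if_strictly_bounded:
  assumes "\<And>x. x \<in> feasible \<Longrightarrow> z \<bullet> x \<le> l" "l < 1"
  shows "z \<in> generators"
proof (rule ccontr)
  assume "z \<notin> generators"
  then have "0 \<notin> (+) (- z) ` generators" by force
  then obtain a where a: "a \<noteq> 0" "\<forall>p \<in> (+) (- z) ` generators. 0 \<le> a \<bullet> p"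
    using separating_hyperplane_set_0[OF convex_translation[OF convex_generators]] by blast
  define x where "x = - a"
  have bound: "x \<bullet> p \<le> x \<bullet> z" if "p \<in> generators" for p
  proof -
    have "0 \<le> a \<bullet> (- z + p)" using a(2) that by blast
    then show ?thesis by (simp add: x_def inner_diff_right)
  qed
  obtain \<mu> where x: "x \<in> K" "A x = \<mu> *\<^sub>R b" "0 \<le> \<mu>" "\<mu> \<le> x \<bullet> z"
    using ray_if_bounded_on_generators[OF bound] by blast
  show False
  proof (cases "\<mu> = 0")
    case True
    then show False using eq_0_if_mem_K_kernel[OF x(1)] x(2) a(1) by (simp add: x_def)
  next
    case False
    then have \<mu>: "\<mu> > 0" using x(3) by simp
    then have "z \<bullet> ((1 / \<mu>) *\<^sub>R x) \<le> l"
      using assms(1) inverse_scaleR_feasible[OF x(1,2)] by blast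
    then have "(z \<bullet> x) / \<mu> \<le> l" by simp
    then have "z \<bullet> x \<le> l * \<mu>" using \<mu> by (simp add: divide_le_eq)
    moreover have "l * \<mu> < \<mu>" using assms(2) \<mu> by simp
    ultimately show False using x(4) by (simp add: inner_commute)
  qed
qed

lemma bounded_generator_of_scaled_polar:
  assumes z: "z \<in> polar feasible" and t: "0 \<le> t" "t < 1" and x0: "x0 \<in> feasible"
  obtains w s where "x0 \<bullet> adjoint A w \<le> 1" "s \<in> dual_cone K" "x0 \<bullet> s \<le> 1 + norm x0 * norm z"
    "t *\<^sub>R z = adjoint A w - s"
proof -
  have "(t *\<^sub>R z) \<bullet> x \<le> t" if "x \<in> feasible" for x
    using z that t(1) mult_left_mono[of "z \<bullet> x" 1 t] by (simp add: polar_def)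
  then obtain w s where ws: "b \<bullet> w \<le> 1" "s \<in> dual_cone K" "t *\<^sub>R z = adjoint A w - s"
    using mem_generators_if_strictly_bounded t(2) unfolding mem_generators by blast
  have "x0 \<bullet> adjoint A w \<le> 1" using ws(1) inner_adjoint[of x0 w] x0 by simp
  moreover have "\<bar>x0 \<bullet> (t *\<^sub>R z)\<bar> \<le> norm x0 * norm z"
    using Cauchy_Schwarz_ineq2[of x0 z] mult_left_le_one_le[of "\<bar>x0 \<bullet> z\<bar>" t] t
    by (simp add: abs_mult)
  moreover have "x0 \<bullet> s = x0 \<bullet> adjoint A w - x0 \<bullet> (t *\<^sub>R z)"
    using ws(3) by (simp add: inner_diff_right)
  ultimately have "x0 \<bullet> s \<le> 1 + norm x0 * norm z" by linarith
  then show ?thesis using that \<open>x0 \<bullet> adjoint A w \<le> 1\<close> ws(2,3) by blast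
qed

lemma polar_feasible_eq_generators: "polar feasible = generators"
proof
  show "polar feasible \<subseteq> generators"
  proof
    fix z assume z: "z \<in> polar feasible"
    obtain x0 r where x0: "x0 \<in> feasible" "r > 0" "cball x0 r \<subseteq> K" by (rule obtain_slater_ball)
    define V where "V = range (adjoint A) \<inter> {v. x0 \<bullet> v \<le> 1}"
    define S where "S = dual_cone K \<inter> {s. x0 \<bullet> s \<le> 1 + norm x0 * norm z}"
    define T where "T = (\<Union>v\<in>V. \<Union>s\<in>S. {v - s})"
    have "closed V" unfolding V_def
      by (intro closed_Int closed_subspace linear_subspace_image[OF linear_adjoint] subspace_UNIV
          closed_halfspace_le)
    then have "closed T"
      unfolding T_def S_def
      using closed_compact_differences compact_dual_cone_Int_halfspace[OF x0(3,2)] by blast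
    have "(\<lambda>n. (1 + - inverse (real (Suc n))) *\<^sub>R z) \<longlonglongrightarrow> 1 *\<^sub>R z"
      by (intro tendsto_scaleR LIMSEQ_inverse_real_of_nat_add_minus tendsto_const)
    moreover have "(1 + - inverse (real (Suc n))) *\<^sub>R z \<in> T" for n
    proof -
      have "0 \<le> 1 + - inverse (real (Suc n))" "1 + - inverse (real (Suc n)) < 1"
        by (auto simp: inverse_le_1_iff)
      then obtain w s where "x0 \<bullet> adjoint A w \<le> 1" "s \<in> S"
          "(1 + - inverse (real (Suc n))) *\<^sub>R z = adjoint A w - s"
        using bounded_generator_of_scaled_polar[OF z _ _ x0(1)] unfolding S_def by blast
      then show ?thesis unfolding T_def V_def by blast
    qed
    ultimately have "z \<in> T" using closed_sequentially[OF \<open>closed T\<close>] by fastforce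
    then obtain w s where "z = adjoint A w - s" "x0 \<bullet> adjoint A w \<le> 1" "s \<in> dual_cone K"
      unfolding T_def V_def S_def by blast
    then show "z \<in> generators"
      unfolding mem_generators using inner_adjoint[of x0 w] x0(1) by auto
  qed
  show "generators \<subseteq> polar feasible" by (rule generators_subset_polar)
qed

lemma polar_feasible_Int_hyperplane:
  assumes x: "x \<in> feasible" and F: "F face_of K" "x \<in> rel_interior F"
  shows "polar feasible \<inter> {z. z \<bullet> x = 1}
           = adjoint A ` {w. b \<bullet> w = 1} + (*\<^sub>R) (-1) ` (dual_cone K \<inter> orth F)"
proof
  have "x \<in> F" using F(2) rel_interior_subset by blast
  show "adjoint A ` {w. b \<bullet> w = 1} + (*\<^sub>R) (-1) ` (dual_cone K \<inter> orth F)
          \<subseteq> polar feasible \<inter> {z. z \<bullet> x = 1}"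
  proof
    fix z assume "z \<in> adjoint A ` {w. b \<bullet> w = 1} + (*\<^sub>R) (-1) ` (dual_cone K \<inter> orth F)"
    then obtain w s where ws: "b \<bullet> w = 1" "s \<in> dual_cone K" "s \<in> orth F" "z = adjoint A w - s"
      by (auto elim!: set_plus_elim)
    then have "z \<in> generators"
      unfolding mem_generators by (intro exI[of _ w] exI[of _ s]) simp
    then have "z \<in> polar feasible" using generators_subset_polar by blast
    moreover have "s \<bullet> x = 0" using ws(3) \<open>x \<in> F\<close> by (simp add: orth_def)
    ultimately show "z \<in> polar feasible \<inter> {z. z \<bullet> x = 1}"
      using ws inner_adjoint_feasible[OF x, of w] by (simp add: inner_diff_left)
  qed
  show "polar feasible \<inter> {z. z \<bullet> x = 1}
          \<subseteq> adjoint A ` {w. b \<bullet> w = 1} + (*\<^sub>R) (-1) ` (dual_cone K \<inter> orth F)"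
  proof
    fix z assume z: "z \<in> polar feasible \<inter> {z. z \<bullet> x = 1}"
    then obtain w s where ws: "b \<bullet> w \<le> 1" "s \<in> dual_cone K" "z = adjoint A w - s"
      by (auto simp: polar_feasible_eq_generators mem_generators)
    have "s \<bullet> x \<ge> 0" using ws(2) x by (simp add: dual_cone_def)
    moreover have "z \<bullet> x = b \<bullet> w - s \<bullet> x"
      using ws(3) inner_adjoint_feasible[OF x, of w] by (simp add: inner_diff_left)
    ultimately have bw: "b \<bullet> w = 1" and sx: "s \<bullet> x = 0" using z ws(1) by auto
    have "s \<bullet> y = 0" if "y \<in> F" for y
      using nonneg_on_convex_vanishes_if_vanishes_at_rel_interior[OF face_of_imp_convex[OF F(1)]
          F(2) _ sx that] ws(2) face_of_imp_subset[OF F(1)] by (auto simp: dual_cone_def)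
    then have "(-1) *\<^sub>R s \<in> (*\<^sub>R) (-1) ` (dual_cone K \<inter> orth F)"
      using ws(2) by (auto simp: orth_def)
    with bw have "adjoint A w + (-1) *\<^sub>R s
        \<in> adjoint A ` {w. b \<bullet> w = 1} + (*\<^sub>R) (-1) ` (dual_cone K \<inter> orth F)"
      by (intro set_plus_intro) auto
    then show "z \<in> adjoint A ` {w. b \<bullet> w = 1} + (*\<^sub>R) (-1) ` (dual_cone K \<inter> orth F)"
      using ws(3) by simp
  qed
qed

lemma rel_interior_polar_feasible_Int_hyperplane_iff:
  assumes "x \<in> feasible" "F face_of K" "x \<in> rel_interior F"
  shows "y \<in> rel_interior (polar feasible \<inter> {z. z \<bullet> x = 1}) \<longleftrightarrow>
           (\<exists>w. b \<bullet> w = 1 \<and> adjoint A w - y \<in> rel_interior (dual_cone K \<inter> orth F))"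
proof -
  define H where "H = adjoint A ` {w. b \<bullet> w = 1}"
  define D where "D = dual_cone K \<inter> orth F"
  have "affine H"
  proof -
    have "H = adjoint A ` (affine hull {w. b \<bullet> w = 1})"
      unfolding H_def using affine_hyperplane affine_hull_eq by metis
    also have "\<dots> = affine hull H"
      unfolding H_def
      by (rule affine_hull_linear_image) (use linear_adjoint linear_conv_bounded_linear in blast)
    finally show ?thesis by (metis affine_affine_hull)
  qed
  have "convex D" unfolding D_def by (intro convex_Int convex_dual_cone convex_orth)
  then have "rel_interior (H + (*\<^sub>R) (-1) ` D) = H + (*\<^sub>R) (-1) ` rel_interior D"
    using rel_interior_sum[OF affine_imp_convex[OF \<open>affine H\<close>] convex_scaling[of D "-1"]]
      rel_interior_affine[OF \<open>affine H\<close>] rel_interior_scaleR[of "-1" D] by simp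
  moreover have "y \<in> H + (*\<^sub>R) (-1) ` rel_interior D \<longleftrightarrow>
      (\<exists>w. b \<bullet> w = 1 \<and> adjoint A w - y \<in> rel_interior D)"
  proof
    assume "y \<in> H + (*\<^sub>R) (-1) ` rel_interior D"
    then show "\<exists>w. b \<bullet> w = 1 \<and> adjoint A w - y \<in> rel_interior D"
      unfolding H_def by (auto elim!: set_plus_elim)
  next
    assume "\<exists>w. b \<bullet> w = 1 \<and> adjoint A w - y \<in> rel_interior D"
    then obtain w where "b \<bullet> w = 1" "adjoint A w - y \<in> rel_interior D" by blast
    then have "adjoint A w + (-1) *\<^sub>R (adjoint A w - y) \<in> H + (*\<^sub>R) (-1) ` rel_interior D"
      unfolding H_def by (intro set_plus_intro imageI) auto
    then show "y \<in> H + (*\<^sub>R) (-1) ` rel_interior D" by simp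
  qed
  ultimately show ?thesis
    using polar_feasible_Int_hyperplane[OF assms] unfolding H_def D_def by simp
qed

lemma exposed_face_of_polar_feasible:
  assumes G: "G exposed_face_of polar feasible" "G \<noteq> {}" "G \<noteq> polar feasible"
  obtains x where "x \<in> feasible" "G = polar feasible \<inter> {z. z \<bullet> x = 1}"
proof -
  obtain a \<beta> where ab: "polar feasible \<subseteq> {z. a \<bullet> z \<le> \<beta>}" "G = polar feasible \<inter> {z. a \<bullet> z = \<beta>}"
    using G(1) unfolding exposed_face_of_def by blast
  have "a \<noteq> 0" using ab G(2,3) by auto
  have "0 \<in> interior (polar feasible)"
    by (rule in_interior_polar_if_strictly_bounded[where m = 0])
      (use compact_imp_bounded[OF compact_feasible] in auto)
  then have "0 \<in> interior {z. a \<bullet> z \<le> \<beta>}" using interior_mono[OF ab(1)] by blast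
  then have "\<beta> > 0" using \<open>a \<noteq> 0\<close> by simp
  define x where "x = (1 / \<beta>) *\<^sub>R a"
  have on_hyperplane: "z \<bullet> x = 1 \<longleftrightarrow> a \<bullet> z = \<beta>" for z
    using \<open>\<beta> > 0\<close> by (auto simp: x_def inner_commute)
  have "x \<bullet> z \<le> 1" if "z \<in> generators" for z
    using ab(1) generators_subset_polar that \<open>\<beta> > 0\<close> by (force simp: x_def divide_le_eq)
  then obtain \<mu> where \<mu>: "x \<in> K" "A x = \<mu> *\<^sub>R b" "0 \<le> \<mu>" "\<mu> \<le> 1"
    using ray_if_bounded_on_generators by blast
  obtain y where y: "y \<in> G" using G(2) by blast
  then have "y \<in> polar feasible" "y \<bullet> x = 1" using ab(2) on_hyperplane by auto
  then have "\<mu> \<noteq> 0" using eq_0_if_mem_K_kernel[OF \<mu>(1)] \<mu>(2) by auto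
  then have "(1 / \<mu>) *\<^sub>R x \<in> feasible" using inverse_scaleR_feasible[OF \<mu>(1,2)] \<mu>(3) by simp
  then have "y \<bullet> ((1 / \<mu>) *\<^sub>R x) \<le> 1"
    using \<open>y \<in> polar feasible\<close> unfolding polar_def by blast
  then have "\<mu> = 1" using \<open>y \<bullet> x = 1\<close> \<open>\<mu> \<noteq> 0\<close> \<mu>(3,4) by (simp add: divide_le_eq)
  then have "x \<in> feasible" using \<mu>(1,2) by simp
  moreover have "G = polar feasible \<inter> {z. z \<bullet> x = 1}" using ab(2) on_hyperplane by auto
  ultimately show ?thesis using that by blast
qed

lemma complementary_slackness:
  assumes "x \<in> feasible" "adjoint A y - c \<in> dual_cone K" "(adjoint A y - c) \<bullet> x = 0"
  shows "primal_optimal A b K c x" "dual_optimal A b K c y"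
proof -
  have cx: "c \<bullet> x = b \<bullet> y"
    using assms(3) inner_adjoint_feasible[OF assms(1)] by (simp add: inner_diff_left)
  show "primal_optimal A b K c x"
    unfolding primal_optimal_def
  proof (intro conjI allI impI)
    fix x' assume "x' \<in> K \<and> A x' = b"
    then have "c \<bullet> x' = b \<bullet> y - (adjoint A y - c) \<bullet> x'" and "(adjoint A y - c) \<bullet> x' \<ge> 0"
      using inner_adjoint_feasible[of x' y] assms(2) by (auto simp: inner_diff_left dual_cone_def)
    then show "c \<bullet> x' \<le> c \<bullet> x" using cx by linarith
  qed (use assms(1) in auto)
  show "dual_optimal A b K c y"
    unfolding dual_optimal_def
  proof (intro conjI allI impI)
    fix y' assume "adjoint A y' - c \<in> dual_cone K"
    then have "0 \<le> (adjoint A y' - c) \<bullet> x" using assms(1) by (simp add: dual_cone_def)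
    then show "b \<bullet> y \<le> b \<bullet> y'"
      using cx inner_adjoint_feasible[OF assms(1), of y'] by (simp add: inner_diff_left)
  qed (use assms(2) in auto)
qed

lemma normalize_objective:
  assumes "\<exists>x\<in>feasible. c \<bullet> x > 0"
  obtains t y where "t > 0" "c = t *\<^sub>R y" "y \<in> polar feasible" "y \<notin> interior (polar feasible)"
proof -
  have "continuous_on feasible (\<lambda>x. c \<bullet> x)" by (intro continuous_intros)
  then obtain x1 where x1: "x1 \<in> feasible" "\<forall>x\<in>feasible. c \<bullet> x \<le> c \<bullet> x1"
    using continuous_attains_sup[OF compact_feasible feasible_nonempty] by blast
  define t where "t = c \<bullet> x1"
  have "t > 0" using assms x1 unfolding t_def by force
  define y where "y = (1 / t) *\<^sub>R c"
  have "c = t *\<^sub>R y" using \<open>t > 0\<close> by (simp add: y_def)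
  moreover have "y \<in> polar feasible"
    using x1 \<open>t > 0\<close> by (auto simp: polar_def y_def t_def divide_le_eq)
  moreover have "y \<bullet> x1 = 1" using \<open>t > 0\<close> by (simp add: y_def t_def)
  then have "y \<notin> interior (polar feasible)"
    using not_in_interior_polar[OF x1(1) nonzero_if_feasible[OF x1(1)]] by simp
  ultimately show ?thesis using that \<open>t > 0\<close> by blast
qed

lemma strictly_complementary_if_facially_exposed:
  assumes "facially_exposed (polar feasible)" "\<exists>x\<in>feasible. c \<bullet> x > 0"
  shows "\<exists>x y. strictly_complementary A b K c x y"
proof -
  obtain t y where ty: "t > 0" "c = t *\<^sub>R y" "y \<in> polar feasible" "y \<notin> interior (polar feasible)"
    using normalize_objective[OF assms(2)] by blast
  then have "y \<notin> rel_interior (polar feasible)"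
    using rel_interior_polar_eq_interior[OF compact_imp_bounded[OF compact_feasible]] by simp
  obtain G where G: "G face_of polar feasible" "y \<in> rel_interior G"
    using exists_face_of_rel_interior[OF convex_polar ty(3)] by blast
  then have "G exposed_face_of polar feasible" "G \<noteq> {}" "G \<noteq> polar feasible"
    using assms(1) \<open>y \<notin> rel_interior (polar feasible)\<close>
    by (auto simp: facially_exposed_def rel_interior_empty)
  then obtain x where x: "x \<in> feasible" "G = polar feasible \<inter> {z. z \<bullet> x = 1}"
    by (rule exposed_face_of_polar_feasible)
  obtain F where F: "F face_of K" "x \<in> rel_interior F"
    using exists_face_of_rel_interior[OF convex_K] x(1) by blast
  then obtain w where w: "b \<bullet> w = 1" "adjoint A w - y \<in> rel_interior (dual_cone K \<inter> orth F)"
    using rel_interior_polar_feasible_Int_hyperplane_iff[OF x(1) F] G(2) x(2) by blast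
  have "adjoint A (t *\<^sub>R w) - c = t *\<^sub>R (adjoint A w - y)"
    by (simp add: ty(2) linear_scale[OF linear_adjoint] scaleR_diff_right)
  then have relint: "adjoint A (t *\<^sub>R w) - c \<in> rel_interior (dual_cone K \<inter> orth F)"
    using rel_interior_conic_scaleR[OF conic_dual_cone_Int_orth ty(1) w(2)] by simp
  then have "adjoint A (t *\<^sub>R w) - c \<in> dual_cone K \<inter> orth F"
    using rel_interior_subset by blast
  moreover have "x \<in> F" using F(2) rel_interior_subset by blast
  ultimately have "adjoint A (t *\<^sub>R w) - c \<in> dual_cone K" "(adjoint A (t *\<^sub>R w) - c) \<bullet> x = 0"
    by (auto simp: orth_def)
  then have "strictly_complementary A b K c x (t *\<^sub>R w)"
    using complementary_slackness[OF x(1)] F relint unfolding strictly_complementary_def by blast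
  then show ?thesis by blast
qed

lemma exposed_face_of_polar_feasible_if_strictly_complementary:
  assumes SC: "\<And>c. \<exists>x\<in>feasible. c \<bullet> x > 0 \<Longrightarrow> \<exists>x y. strictly_complementary A b K c x y"
    and G: "G face_of polar feasible"
  shows "G exposed_face_of polar feasible"
proof (cases "G = {} \<or> G = polar feasible")
  case True
  then show ?thesis using convex_polar by auto
next
  case False
  then obtain y where y: "y \<in> rel_interior G"
    using G face_of_imp_convex rel_interior_eq_empty by blast
  then have "y \<in> G" using rel_interior_subset by blast
  then have "y \<in> polar feasible" using face_of_imp_subset[OF G] by blast
  have "y \<in> rel_frontier (polar feasible)"
    using face_of_subset_rel_frontier[OF G] False \<open>y \<in> G\<close> by blast
  then have "y \<notin> interior (polar feasible)"
    using rel_interior_polar_eq_interior[OF compact_imp_bounded[OF compact_feasible]]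
    by (simp add: rel_frontier_def)
  then obtain x1 where x1: "x1 \<in> feasible" "y \<bullet> x1 = 1"
    using polar_frontier_point_attained[OF compact_feasible feasible_nonempty \<open>y \<in> polar feasible\<close>]
    by blast
  then obtain x w F where "primal_optimal A b K y x" "F face_of K" "x \<in> rel_interior F"
      and slack: "adjoint A w - y \<in> rel_interior (dual_cone K \<inter> orth F)"
    using SC[of y] unfolding strictly_complementary_def by fastforce
  then have x: "x \<in> feasible" "y \<bullet> x = 1"
    using x1 \<open>y \<in> polar feasible\<close> by (force simp: primal_optimal_def polar_def)+
  have "x \<in> F" using \<open>x \<in> rel_interior F\<close> rel_interior_subset by blast
  then have "(adjoint A w - y) \<bullet> x = 0"
    using slack rel_interior_subset by (fastforce simp: orth_def)
  then have "b \<bullet> w = 1" using inner_adjoint_feasible[OF x(1)] x(2) by (simp add: inner_diff_left)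
  then have "y \<in> rel_interior (polar feasible \<inter> {z. z \<bullet> x = 1})"
    using rel_interior_polar_feasible_Int_hyperplane_iff[OF x(1) \<open>F face_of K\<close> \<open>x \<in> rel_interior F\<close>]
      slack by blast
  then have "G = polar feasible \<inter> {z. z \<bullet> x = 1}"
    using face_of_eq[OF G] y exposed_face_of_polar_Int_hyperplane[OF x(1)] exposed_face_of_def
    by blast
  then show ?thesis using exposed_face_of_polar_Int_hyperplane[OF x(1)] by simp
qed

end

theorem theorem4p5:
  fixes K :: "'e::euclidean_space set"
    and A :: "'e \<Rightarrow> 'f::euclidean_space"
    and b :: 'f
  assumes "closed K" and "convex K" and "conic K"
    and "K \<inter> uminus ` K = {0}"
    and "interior K \<noteq> {}"
    and "linear A"
    and "{x \<in> K. A x = b} \<inter> interior K \<noteq> {}"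
    and "compact {x \<in> K. A x = b}"
  shows "(\<forall>c. c \<notin> polar (convex_cone hull {x \<in> K. A x = b}) \<longrightarrow>
              (\<exists>x y. strictly_complementary A b K c x y))
         \<longleftrightarrow> facially_exposed (polar {x \<in> K. A x = b})"
proof -
  interpret compact_conic_program K A b by (intro compact_conic_program.intro assms)
  have objective: "c \<notin> polar (convex_cone hull feasible) \<longleftrightarrow> (\<exists>x\<in>feasible. c \<bullet> x > 0)" for c
    by (auto simp: polar_convex_cone_hull not_le)
  show ?thesis
    unfolding objective
    using strictly_complementary_if_facially_exposed
      exposed_face_of_polar_feasible_if_strictly_complementary
    by (auto simp: facially_exposed_def)
qed

end
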